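(* Let $G$ be a graph with $m$ edges and $\lambda(G)>\sqrt m$. Then $G$ contains more than $\frac12\sqrt m$ triangular edges.
   Context: Graphs are finite and simple. $\lambda(G)$ is the largest eigenvalue of the adjacency matrix of $G$. An edge of $G$ is called triangular if it lies in a triangle of $G$. *)

theory Defs
  imports Complex_Main "Jordan_Normal_Form.Char_Poly"
begin

definition finite_simple_graph :: "'a set \<Rightarrow> 'a set set \<Rightarrow> bool" where
  "finite_simple_graph V E \<longleftrightarrow> finite V \<and> (\<forall>e\<in>E. e \<subseteq> V \<and> card e = 2)"

(* The list vs is an ordering of the vertices: row and column i belong to the vertex vs ! i.
   Diagonal entries of a simple graph vanish, since {v, v} has cardinality 1. *)
definition adjacency_matrix :: "'a list \<Rightarrow> 'a set set \<Rightarrow> real mat" where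
  "adjacency_matrix vs E =
     mat (length vs) (length vs) (\<lambda>(i, j). if {vs ! i, vs ! j} \<in> E then 1 else 0)"

(* Only meaningful if A has finitely many, and at least one, real eigenvalues,
   as a nonempty real symmetric matrix does. *)
definition largest_eigenvalue :: "real mat \<Rightarrow> real" where
  "largest_eigenvalue A = Max {k. eigenvalue A k}"

(* In a simple graph the three vertices are automatically distinct. *)
definition triangle :: "'a set set \<Rightarrow> 'a \<Rightarrow> 'a \<Rightarrow> 'a \<Rightarrow> bool" where
  "triangle E u v w \<longleftrightarrow> {u, v} \<in> E \<and> {v, w} \<in> E \<and> {u, w} \<in> E"

definition triangular_edges :: "'a set set \<Rightarrow> 'a set set" where
  "triangular_edges E = {e \<in> E. \<exists>u v w. triangle E u v w \<and> e \<subseteq> {u, v, w}}"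

end

theory Submission
  imports Defs "HOL-Analysis.Function_Topology" "Jordan_Normal_Form.Spectral_Radius"
begin

text \<open>Let \<open>\<mu>\<close> be the largest eigenvalue, with a nonnegative eigenvector \<open>x\<close> scaled so that its largest entry is
\<open>x u = 1\<close>. Let \<open>P\<close> be the neighbourhood of \<open>u\<close> and \<open>U\<close> the set of the other vertices, with \<open>s\<close> and \<open>t\<close> edges
inside, and let \<open>d v\<close> be the number of neighbours of \<open>v\<close> in \<open>P\<close>. Counting walks of length two from \<open>u\<close>
gives \<open>\<mu>\<^sup>2\<close> as the sum of \<open>d v * x v\<close>, whereas the number of edges is the sum of \<open>d w\<close> over \<open>w \<in> U\<close> plus
\<open>s + t\<close>. So \<open>\<mu>\<^sup>2 > card E\<close> means (\<open>deficit\<close>) that the total deficit, the sum of \<open>d w * (1 - x w)\<close> over \<open>U\<close>, plus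
\<open>t\<close> is less than \<open>\<sigma>\<close>, the sum of \<open>x a + x b - 1\<close> over the edges \<open>{a, b}\<close> inside \<open>P\<close>. In particular some such edge is
heavy, that is, \<open>x a + x b > 1\<close>.

Call \<open>w \<in> U\<close> bad if it is adjacent to both ends of some edge inside \<open>P\<close>. Bad vertices produce triangular
edges (\<open>triangular_lower\<close>), so assume that there are few. A heavy edge \<open>{a, b}\<close> has neighbourhoods of total
weight above \<open>\<mu>\<close> that meet inside \<open>U\<close> only in bad vertices, so the good vertices must have large weight
(\<open>heavy_edge_bound\<close>). On the other hand, for a good \<open>w\<close> the vertices of \<open>P\<close> not adjacent to \<open>w\<close> cover all edges inside
\<open>P\<close>, so they weigh at least \<open>\<sigma> / D\<close> with \<open>D\<close> the maximal degree inside \<open>P\<close> (\<open>cover\<close>). This weight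
is missing at \<open>w\<close>, and the resulting deficits would exceed \<open>\<sigma>\<close> unless the total weight of the good
vertices were less than \<open>D\<close>, up to a correction for the edges inside \<open>U\<close> (\<open>good_weight\<close>). Since
\<open>t < \<sigma>\<close>, this correction is at most of the order of \<open>D\<close> as well. The two bounds together yield \<open>\<mu> < 2 * T\<close> for the number
\<open>T\<close> of triangular edges, which is more than is claimed.\<close>

section \<open>Nonnegative eigenvectors of symmetric matrices\<close>

lemma nonneg_on_line_imp_slope_zero:
  fixes b c :: real
  assumes "\<And>t. 0 \<le> 2 * t * b + t\<^sup>2 * c"
  shows "b = 0"
proof (rule ccontr)
  assume "b \<noteq> 0"
  define t where "t = - b / (\<bar>c\<bar> + 1)"
  have b: "b = - (t * (\<bar>c\<bar> + 1))" by (simp add: t_def add_nonneg_eq_0_iff)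
  have "2 * t * b + t\<^sup>2 * c = t\<^sup>2 * (c - 2 * (\<bar>c\<bar> + 1))"
    unfolding b by (simp add: power2_eq_square algebra_simps)
  moreover have "t\<^sup>2 * (c - 2 * (\<bar>c\<bar> + 1)) < 0"
    using \<open>b \<noteq> 0\<close> by (intro mult_pos_neg) (auto simp: t_def)
  ultimately show False using assms[of t] by linarith
qed

text \<open>The part of the Perron-Frobenius theorem that symmetric matrices need, by the variational argument.
The quadratic form \<open>q\<close> attains a maximum \<open>\<mu>\<close> over the nonnegative unit vectors, which form a compact
set. Replacing the entries of a vector by their absolute values keeps its norm and does not decrease
\<open>q\<close>, so \<open>q f \<le> \<mu> * r f\<close> for all \<open>f\<close>, where \<open>r\<close> is the squared norm. This bounds every eigenvalue by
\<open>\<mu>\<close>; and as the form \<open>\<mu> * r - q\<close> is nonnegative and vanishes at the maximiser \<open>x\<close>, its derivative at \<open>x\<close>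
vanishes in every direction, which says that \<open>x\<close> is an eigenvector for \<open>\<mu>\<close>.\<close>
lemma perron_vector:
  fixes M :: "'i \<Rightarrow> 'i \<Rightarrow> real"
  assumes fin: "finite V" and ne: "V \<noteq> {}"
    and sym: "\<And>i j. i \<in> V \<Longrightarrow> j \<in> V \<Longrightarrow> M i j = M j i"
    and nonneg: "\<And>i j. i \<in> V \<Longrightarrow> j \<in> V \<Longrightarrow> 0 \<le> M i j"
  obtains \<mu> x where "\<And>i. i \<in> V \<Longrightarrow> 0 \<le> x i" and "\<exists>i\<in>V. 0 < x i"
    and "\<And>i. i \<in> V \<Longrightarrow> (\<Sum>j\<in>V. M i j * x j) = \<mu> * x i"
    and "\<And>k y i. \<lbrakk>i \<in> V; y i \<noteq> 0; \<And>i. i \<in> V \<Longrightarrow> (\<Sum>j\<in>V. M i j * y j) = k * y i\<rbrakk> \<Longrightarrow> k \<le> \<mu>"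
proof -
  define q where "q = (\<lambda>f::'i \<Rightarrow> real. \<Sum>i\<in>V. \<Sum>j\<in>V. M i j * f i * f j)"
  define r where "r = (\<lambda>f::'i \<Rightarrow> real. \<Sum>i\<in>V. (f i)\<^sup>2)"
  \<comment> \<open>Coordinates outside \<open>V\<close> are pinned to \<open>0\<close>, so that Tychonoff makes the box compact.\<close>
  define K where "K = (PiE UNIV (\<lambda>i. if i \<in> V then {0..1::real} else {0})) \<inter> {f. r f = 1}"
  have r_pos: "0 < r f" if "i \<in> V" "f i \<noteq> 0" for f i
    using fin that unfolding r_def by (intro sum_pos2[of _ i]) auto
  have scale: "q (\<lambda>i. c * f i) = c\<^sup>2 * q f" "r (\<lambda>i. c * f i) = c\<^sup>2 * r f" for c f
    by (auto simp: q_def r_def sum_distrib_left power2_eq_square algebra_simps intro!: sum.cong)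
  have "compact (PiE UNIV (\<lambda>i. if i \<in> V then {0..1::real} else {0}))"
    unfolding compactin_euclidean_iff[symmetric] euclidean_product_topology[symmetric]
    by (subst compactin_PiE) auto
  moreover have "closed {f. r f = 1}" unfolding r_def
    by (intro closed_Collect_eq continuous_intros) auto
  ultimately have "compact K" unfolding K_def by (rule compact_Int_closed)
  have normal: "\<exists>c>0. (\<lambda>i. c * (if i \<in> V then \<bar>f i\<bar> else 0)) \<in> K \<and> c\<^sup>2 * r f = 1"
    if i: "i \<in> V" "f i \<noteq> 0" for f i
  proof -
    define c where "c = 1 / sqrt (r f)"
    have c: "c > 0" "c\<^sup>2 * r f = 1"
      using r_pos[of i f] i by (auto simp: c_def power_divide)
    have "r (\<lambda>i. if i \<in> V then \<bar>f i\<bar> else 0) = r f" by (simp add: r_def)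
    then have r1: "r (\<lambda>i. c * (if i \<in> V then \<bar>f i\<bar> else 0)) = 1" using c by (simp add: scale)
    have "c * \<bar>f j\<bar> \<le> 1" if "j \<in> V" for j
    proof -
      have "(c * \<bar>f j\<bar>)\<^sup>2 \<le> r (\<lambda>i. c * (if i \<in> V then \<bar>f i\<bar> else 0))"
        unfolding r_def using member_le_sum[of j V "\<lambda>i. (c * (if i \<in> V then \<bar>f i\<bar> else 0))\<^sup>2"] fin that
        by auto
      then show ?thesis using r1 c(1) by (simp add: abs_square_le_1 abs_mult)
    qed
    then show ?thesis using c r1 by (auto simp: K_def intro!: exI[of _ c])
  qed
  have "K \<noteq> {}" using ne normal[of _ "\<lambda>_. 1"] by fastforce
  moreover have "continuous_on K q" unfolding q_def
    by (intro continuous_intros continuous_on_subset[OF continuous_on_product_coordinates]) auto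
  ultimately obtain x where xK: "x \<in> K" and xmax: "\<And>y. y \<in> K \<Longrightarrow> q y \<le> q x"
    using continuous_attains_sup[OF \<open>compact K\<close>] by metis
  define \<mu> where "\<mu> = q x"
  have rx: "r x = 1" using xK by (simp add: K_def)
  have rayleigh: "q f \<le> \<mu> * r f" for f
  proof (cases "\<exists>i\<in>V. f i \<noteq> 0")
    case True
    then obtain c where c: "c > 0" "(\<lambda>i. c * (if i \<in> V then \<bar>f i\<bar> else 0)) \<in> K" "c\<^sup>2 * r f = 1"
      using normal by blast
    have "q f \<le> q (\<lambda>i. if i \<in> V then \<bar>f i\<bar> else 0)" unfolding q_def
      by (intro sum_mono) (auto simp: mult.assoc abs_mult[symmetric] intro!: mult_left_mono nonneg)
    then have "c\<^sup>2 * q f \<le> c\<^sup>2 * q (\<lambda>i. if i \<in> V then \<bar>f i\<bar> else 0)"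
      by (intro mult_left_mono) auto
    also have "\<dots> \<le> \<mu> * (c\<^sup>2 * r f)" using xmax[OF c(2)] unfolding scale c(3) by (simp add: \<mu>_def)
    finally have "c\<^sup>2 * q f \<le> c\<^sup>2 * (\<mu> * r f)" by (simp add: algebra_simps)
    then show ?thesis using c(1) by simp
  next
    case False
    then show ?thesis by (simp add: q_def r_def)
  qed
  show ?thesis
  proof
    show x0: "0 \<le> x i" if "i \<in> V" for i using xK that by (auto simp: K_def PiE_iff split: if_splits)
    show "\<exists>i\<in>V. 0 < x i"
    proof (rule ccontr)
      assume "\<not> ?thesis"
      then have "x i = 0" if "i \<in> V" for i using x0[OF that] that by force
      then show False using rx by (simp add: r_def)
    qed
    \<comment> \<open>The derivative of \<open>\<mu> * r - q\<close> at \<open>x\<close> in direction \<open>g\<close>, halved.\<close>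
    have orth: "(\<Sum>i\<in>V. g i * (\<mu> * x i - (\<Sum>j\<in>V. M i j * x j))) = 0" for g
    proof (rule nonneg_on_line_imp_slope_zero)
      fix t
      have "(\<Sum>i\<in>V. \<Sum>j\<in>V. M i j * x i * g j) = (\<Sum>i\<in>V. \<Sum>j\<in>V. M i j * g i * x j)"
        by (subst sum.swap) (auto intro!: sum.cong simp: sym)
      moreover have "q (\<lambda>i. x i + t * g i) = q x + t * (\<Sum>i\<in>V. \<Sum>j\<in>V. M i j * x i * g j)
          + t * (\<Sum>i\<in>V. \<Sum>j\<in>V. M i j * g i * x j) + t\<^sup>2 * q g"
        by (simp add: q_def algebra_simps sum.distrib sum_distrib_left power2_eq_square)
      ultimately have "q (\<lambda>i. x i + t * g i) = q x + 2 * t * (\<Sum>i\<in>V. \<Sum>j\<in>V. M i j * g i * x j) + t\<^sup>2 * q g"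
        by simp
      moreover have "r (\<lambda>i. x i + t * g i) = r x + 2 * t * (\<Sum>i\<in>V. g i * x i) + t\<^sup>2 * r g"
        by (simp add: r_def algebra_simps sum.distrib sum_distrib_left power2_eq_square)
      ultimately have "0 \<le> 2 * t * (\<mu> * (\<Sum>i\<in>V. g i * x i) - (\<Sum>i\<in>V. \<Sum>j\<in>V. M i j * g i * x j))
          + t\<^sup>2 * (\<mu> * r g - q g)"
        using rayleigh[of "\<lambda>i. x i + t * g i"] rx by (simp add: algebra_simps \<mu>_def)
      then show "0 \<le> 2 * t * (\<Sum>i\<in>V. g i * (\<mu> * x i - (\<Sum>j\<in>V. M i j * x j)))
          + t\<^sup>2 * (\<mu> * r g - q g)"
        by (simp add: algebra_simps sum_distrib_left sum_subtractf)
    qed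
    show "(\<Sum>j\<in>V. M i j * x j) = \<mu> * x i" if "i \<in> V" for i
      using orth[of "\<lambda>j. if j = i then 1 else 0"] fin that by (simp add: if_distrib[of "\<lambda>z. z * _"] cong: if_cong)
    show "k \<le> \<mu>" if y: "i \<in> V" "y i \<noteq> 0" "\<And>i. i \<in> V \<Longrightarrow> (\<Sum>j\<in>V. M i j * y j) = k * y i" for k y i
    proof -
      have "q y = (\<Sum>i\<in>V. y i * (\<Sum>j\<in>V. M i j * y j))"
        by (simp add: q_def sum_distrib_left algebra_simps)
      also have "\<dots> = (\<Sum>i\<in>V. y i * (k * y i))"
        using y(3) by simp
      also have "\<dots> = k * r y" by (simp add: r_def sum_distrib_left algebra_simps power2_eq_square)
      finally show ?thesis using rayleigh[of y] r_pos[of i y] y by simp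
    qed
  qed
qed

text \<open>The eigenvalue of the vector just found bounds all real eigenvalues, so it is the maximum in
the definition of \<open>largest_eigenvalue\<close>.\<close>
lemma largest_eigenvalue_nonneg_eigenvector:
  assumes A: "A \<in> carrier_mat n n" and n: "0 < n"
    and sym: "\<And>i j. i < n \<Longrightarrow> j < n \<Longrightarrow> A $$ (i, j) = A $$ (j, i)"
    and nonneg: "\<And>i j. i < n \<Longrightarrow> j < n \<Longrightarrow> 0 \<le> A $$ (i, j)"
  obtains x where "\<And>i. i < n \<Longrightarrow> 0 \<le> x i" and "\<exists>i<n. 0 < x i"
    and "\<And>i. i < n \<Longrightarrow> (\<Sum>j<n. A $$ (i, j) * x j) = largest_eigenvalue A * x i"
proof -
  have row: "(A *\<^sub>v v) $ i = (\<Sum>j<n. A $$ (i, j) * v $ j)" if "v \<in> carrier_vec n" "i < n" for v i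
    using A that by (auto simp: scalar_prod_def lessThan_atLeast0 intro!: sum.cong)
  show ?thesis
  proof (rule perron_vector[of "{..<n}" "\<lambda>i j. A $$ (i, j)"])
    fix \<mu> x
    assume x: "\<And>i. i \<in> {..<n} \<Longrightarrow> 0 \<le> x i" "\<exists>i\<in>{..<n}. 0 < x i"
        "\<And>i. i \<in> {..<n} \<Longrightarrow> (\<Sum>j<n. A $$ (i, j) * x j) = \<mu> * x i"
      and max: "\<And>k y i. \<lbrakk>i \<in> {..<n}; y i \<noteq> 0;
        \<And>i. i \<in> {..<n} \<Longrightarrow> (\<Sum>j<n. A $$ (i, j) * y j) = k * y i\<rbrakk> \<Longrightarrow> k \<le> \<mu>"
    have "eigenvector A (vec n x) \<mu>"
      unfolding eigenvector_def
    proof (intro conjI)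
      show "vec n x \<noteq> 0\<^sub>v (dim_row A)" using x(2) A by (auto simp: vec_eq_iff)
      show "A *\<^sub>v vec n x = \<mu> \<cdot>\<^sub>v vec n x"
      proof (rule eq_vecI)
        fix i assume "i < dim_vec (\<mu> \<cdot>\<^sub>v vec n x)"
        then show "(A *\<^sub>v vec n x) $ i = (\<mu> \<cdot>\<^sub>v vec n x) $ i" using x(3)[of i] row[of "vec n x" i] by simp
      qed (use A in auto)
    qed (use A in auto)
    then have "eigenvalue A \<mu>" by (auto simp: eigenvalue_def)
    moreover have "k \<le> \<mu>" if ev: "eigenvalue A k" for k
    proof -
      obtain v where v: "v \<in> carrier_vec n" "v \<noteq> 0\<^sub>v n" "A *\<^sub>v v = k \<cdot>\<^sub>v v"
        using ev A by (auto simp: eigenvalue_def eigenvector_def)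
      then obtain i where "i < n" "v $ i \<noteq> 0" by (metis carrier_vecD eq_vecI index_zero_vec)
      moreover have "(\<Sum>j<n. A $$ (i, j) * v $ j) = k * v $ i" if "i < n" for i
        using row[OF v(1) that] v that by simp
      ultimately show ?thesis using max[of i "\<lambda>i. v $ i" k] by simp
    qed
    moreover have "finite {k. eigenvalue A k}"
      using card_finite_spectrum(1)[OF A] by (simp add: spectrum_def)
    ultimately have "largest_eigenvalue A = \<mu>"
      unfolding largest_eigenvalue_def by (intro Max_eqI) auto
    then show ?thesis using that x by auto
  qed (use n sym nonneg in auto)
qed

section \<open>Edge counts in simple graphs\<close>

locale simple_graph =
  fixes V :: "'a set" and E :: "'a set set"
  assumes graph: "finite_simple_graph V E"
begin

definition nbs :: "'a set \<Rightarrow> 'a \<Rightarrow> 'a set" where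
  "nbs S v = {w \<in> S. {v, w} \<in> E}"

lemma finite_V: "finite V" and edge_subset: "e \<in> E \<Longrightarrow> e \<subseteq> V" and edge_card: "e \<in> E \<Longrightarrow> card e = 2"
  using graph by (auto simp: finite_simple_graph_def)

lemma finite_E: "finite E"
  by (rule finite_subset[of E "Pow V"]) (use edge_subset finite_V in auto)

lemma not_adjacent_self: "{v, v} \<notin> E"
  using edge_card[of "{v, v}"] by auto

lemma finite_nbs: "finite S \<Longrightarrow> finite (nbs S v)"
  by (simp add: nbs_def)

lemma sum_nbs_swap:
  assumes "finite S" "finite T"
  shows "(\<Sum>v\<in>S. \<Sum>w\<in>nbs T v. f v w) = (\<Sum>w\<in>T. \<Sum>v\<in>nbs S w. f v w)"
  unfolding nbs_def using sum.swap_restrict[OF assms, of f "\<lambda>v w. {v, w} \<in> E"]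
  by (simp add: insert_commute)

lemma handshake:
  assumes "finite S"
  shows "(\<Sum>v\<in>S. card (nbs S v)) = 2 * card {e \<in> E. e \<subseteq> S}"
proof -
  define R where "R = (SIGMA v:S. nbs S v)"
  have "(\<Sum>v\<in>S. card (nbs S v)) = card R"
    using assms by (simp add: R_def finite_nbs)
  also have "R = (\<Union>e\<in>{e \<in> E. e \<subseteq> S}. {(v, w). {v, w} = e})"
    by (auto simp: R_def nbs_def)
  also have "card \<dots> = (\<Sum>e\<in>{e \<in> E. e \<subseteq> S}. card {(v, w). {v, w} = e})"
  proof (rule card_UN_disjoint)
    show "\<forall>e\<in>{e \<in> E. e \<subseteq> S}. finite {(v, w). {v, w} = e}"
    proof
      fix e assume "e \<in> {e \<in> E. e \<subseteq> S}"
      then show "finite {(v, w). {v, w} = e}"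
        by (intro finite_subset[OF _ finite_cartesian_product[OF assms assms]]) auto
    qed
  qed (use finite_E in auto)
  also have "\<dots> = (\<Sum>e\<in>{e \<in> E. e \<subseteq> S}. 2)"
  proof (rule sum.cong)
    fix e assume "e \<in> {e \<in> E. e \<subseteq> S}"
    then obtain a b where ab: "e = {a, b}" "a \<noteq> b" using edge_card[of e] by (auto simp: card_2_iff)
    then have "{(v, w). {v, w} = e} = {(a, b), (b, a)}" by (auto simp: doubleton_eq_iff)
    then show "card {(v, w). {v, w} = e} = 2" using ab by simp
  qed simp
  finally show ?thesis by simp
qed

end

section \<open>Weights around a vertex of largest weight\<close>

text \<open>The lower bounds \<open>h - p\<close> and \<open>k - q\<close> may be negative, so they cannot simply be multiplied; but if one of
them is, then the left-hand side is at most \<open>0\<close>.\<close>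
lemma mult_minus_minus_lower:
  fixes p q h k :: real
  assumes "0 \<le> p" "0 \<le> q" "0 \<le> h" "0 \<le> k" "h - p \<le> y" "0 \<le> y" "k - q \<le> z" "0 \<le> z"
  shows "h * k - p * k - h * q \<le> y * z"
proof (cases "h \<le> p \<or> k \<le> q")
  case True
  then have "h * k - p * k - h * q \<le> 0"
  proof
    assume "h \<le> p"
    then have "h * k \<le> p * k" using assms by (intro mult_right_mono) auto
    moreover have "0 \<le> h * q" using assms by simp
    ultimately show ?thesis by simp
  next
    assume "k \<le> q"
    then have "h * k \<le> h * q" using assms by (intro mult_left_mono) auto
    moreover have "0 \<le> p * k" using assms by simp
    ultimately show ?thesis by simp
  qed
  also have "0 \<le> y * z" using assms by simp
  finally show ?thesis .
next
  case False
  have "h * k - p * k - h * q \<le> (h - p) * (k - q)" using assms by (simp add: algebra_simps)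
  also have "\<dots> \<le> y * z" using assms False by (intro mult_mono) auto
  finally show ?thesis .
qed

locale perron_graph = simple_graph +
  fixes x :: "'a \<Rightarrow> real" and \<mu> :: real and u :: 'a
  assumes x_nonneg: "v \<in> V \<Longrightarrow> 0 \<le> x v" and x_le_1: "v \<in> V \<Longrightarrow> x v \<le> 1"
    and u_in_V: "u \<in> V" and x_u: "x u = 1"
    and eigen: "v \<in> V \<Longrightarrow> (\<Sum>w\<in>nbs V v. x w) = \<mu> * x v"
    and mu_pos: "0 < \<mu>" and edges_less_mu_sq: "real (card E) < \<mu>\<^sup>2"
begin

text \<open>\<open>P\<close> consists of the neighbours of the vertex \<open>u\<close> of largest weight and \<open>U\<close> of the other vertices, so
\<open>u \<in> U\<close>; in a complete bipartite graph they are the two sides. \<open>s\<close> and \<open>t\<close> count the edges inside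
them, and \<open>d v\<close> counts the neighbours of \<open>v\<close> in \<open>P\<close>, also for \<open>v \<in> P\<close>. By a handshake count
\<open>\<sigma>\<close> is the sum of \<open>x a + x b - 1\<close> over the edges \<open>{a, b}\<close> inside \<open>P\<close>: what these edges contribute to
\<open>\<mu>\<^sup>2 - card E\<close>. A vertex of \<open>U\<close> is bad if it forms a triangle with an edge inside \<open>P\<close>,
and good otherwise.\<close>
definition "P = nbs V u"
definition "U = V - P"
definition "d v = card (nbs P v)"
definition "s = card {e \<in> E. e \<subseteq> P}"
definition "t = card {e \<in> E. e \<subseteq> U}"
definition "D = Max (d ` P)"
definition "\<sigma> = (\<Sum>a\<in>P. d a * x a) - s"
definition "\<beta> = \<sigma> / D"
definition "bad = {w \<in> U. \<exists>a\<in>P. \<exists>b\<in>P. {a, b} \<in> E \<and> {w, a} \<in> E \<and> {w, b} \<in> E}"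
definition "X = (\<Sum>w\<in>U - bad. x w)"
definition "n w = (\<Sum>z\<in>nbs U w. x z)"

lemma sub: "P \<subseteq> V" "U \<subseteq> V" "bad \<subseteq> U" "P \<inter> U = {}" "P \<union> U = V"
  by (auto simp: P_def U_def bad_def nbs_def)

lemma fin: "finite P" "finite U" "finite bad" "finite (nbs P v)" "finite (nbs U v)" "finite (nbs V v)"
  using finite_subset[OF sub(1) finite_V] finite_subset[OF sub(2) finite_V] finite_V
    finite_subset[OF sub(3)] by (auto simp: finite_nbs)

lemma u_in_U: "u \<in> U"
  using u_in_V not_adjacent_self by (auto simp: U_def P_def nbs_def)

lemma nbs_split: "nbs V v = nbs P v \<union> nbs U v" "nbs P v \<inter> nbs U v = {}"
  using sub by (auto simp: nbs_def)

lemma sum_nbs_split: "(\<Sum>w\<in>nbs V v. f w) = (\<Sum>w\<in>nbs P v. f w) + (\<Sum>w\<in>nbs U v. f w)"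
  unfolding nbs_split(1) using nbs_split(2) fin by (intro sum.union_disjoint) auto

lemma sum_split: "(\<Sum>v\<in>V. f v) = (\<Sum>v\<in>P. f v) + (\<Sum>v\<in>U. f v)"
  using sum.union_disjoint[OF fin(1,2) sub(4), of f] by (simp add: sub(5))

text \<open>The edges are sorted by how many ends they have in \<open>P\<close>: those with exactly one are the ones counted by
the sum over \<open>U\<close>.\<close>
lemma card_edges: "card E = (\<Sum>w\<in>U. d w) + s + t"
proof -
  have "{e \<in> E. e \<subseteq> V} = E" using edge_subset by auto
  then have "2 * card E = (\<Sum>v\<in>V. card (nbs V v))" using handshake[OF finite_V] by simp
  also have "\<dots> = (\<Sum>v\<in>V. d v + card (nbs U v))"
    by (intro sum.cong) (auto simp: d_def nbs_split fin card_Un_disjoint)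
  also have "\<dots> = (\<Sum>w\<in>U. d w) + (\<Sum>a\<in>P. card (nbs U a)) + (\<Sum>a\<in>P. d a) + (\<Sum>w\<in>U. card (nbs U w))"
    by (simp add: sum_split sum.distrib)
  also have "(\<Sum>a\<in>P. card (nbs U a)) = (\<Sum>w\<in>U. d w)"
    using sum_nbs_swap[OF fin(1,2), of "\<lambda>_ _. 1::nat"] by (simp add: d_def)
  finally show ?thesis using handshake[OF fin(1)] handshake[OF fin(2)] by (simp add: d_def s_def t_def)
qed

lemma sum_d_P: "(\<Sum>a\<in>P. d a) = 2 * s"
  using handshake[OF fin(1)] by (simp add: d_def s_def)

lemma sum_P: "(\<Sum>a\<in>P. x a) = \<mu>"
  using eigen[OF u_in_V] by (simp add: P_def x_u)

text \<open>The eigenvalue equation used twice, at \<open>u\<close> and at its neighbours: \<open>\<mu>\<^sup>2 = \<mu>\<^sup>2 * x u\<close> is the weight of the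
ends of all walks of length two from \<open>u\<close>, and \<open>d v\<close> of these end at \<open>v\<close>.\<close>
lemma mu_sq: "\<mu>\<^sup>2 = (\<Sum>v\<in>V. d v * x v)"
proof -
  have "\<mu>\<^sup>2 = (\<Sum>a\<in>P. \<mu> * x a)" by (simp add: sum_P power2_eq_square flip: sum_distrib_left)
  also have "\<dots> = (\<Sum>a\<in>P. \<Sum>v\<in>nbs V a. x v)" using eigen sub by (intro sum.cong) auto
  also have "\<dots> = (\<Sum>v\<in>V. d v * x v)" by (subst sum_nbs_swap) (auto simp: fin finite_V d_def)
  finally show ?thesis .
qed

text \<open>The comparison of \<open>\<mu>\<^sup>2\<close> with the number of edges on which everything rests. An edge between \<open>P\<close> and \<open>U\<close>
costs \<open>1\<close> in \<open>card E\<close> and returns only the weight of its end in \<open>U\<close>, and an edge inside \<open>U\<close> returns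
nothing; only edges inside \<open>P\<close>, which are triangular, can make up for this.\<close>
lemma deficit: "(\<Sum>w\<in>U. d w * (1 - x w)) + t < \<sigma>"
  using edges_less_mu_sq unfolding mu_sq sum_split card_edges \<sigma>_def by (simp add: algebra_simps sum_subtractf)

lemma \<sigma>_le: "\<sigma> \<le> s"
proof -
  have "(\<Sum>a\<in>P. d a * x a) \<le> (\<Sum>a\<in>P. real (d a) * 1)"
    using x_le_1 sub by (intro sum_mono mult_left_mono) auto
  also have "\<dots> = 2 * s" using sum_d_P by (simp flip: of_nat_sum)
  finally show ?thesis by (simp add: \<sigma>_def)
qed

lemma deficit_nonneg: "0 \<le> (\<Sum>w\<in>U. d w * (1 - x w))"
  using x_le_1 sub by (intro sum_nonneg mult_nonneg_nonneg) auto

lemma t_less_\<sigma>: "t < \<sigma>"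
  using deficit deficit_nonneg by simp

lemma t_less_s: "t < s"
  using t_less_\<sigma> \<sigma>_le by linarith

lemma two_\<sigma>: "2 * \<sigma> = (\<Sum>a\<in>P. \<Sum>b\<in>nbs P a. x a + x b - 1)"
proof -
  have "(\<Sum>a\<in>P. \<Sum>b\<in>nbs P a. x b) = (\<Sum>a\<in>P. d a * x a)"
    by (subst sum_nbs_swap) (auto simp: fin d_def)
  moreover have "(\<Sum>a\<in>P. real (d a)) = 2 * s" using sum_d_P by (simp flip: of_nat_sum)
  ultimately show ?thesis
    by (simp add: sum.distrib sum_subtractf \<sigma>_def d_def)
qed

lemma heavy_edge: obtains a b where "a \<in> P" "b \<in> P" "{a, b} \<in> E" "1 < x a + x b"
proof -
  have "\<exists>a\<in>P. \<exists>b\<in>nbs P a. 0 < x a + x b - 1"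
  proof (rule ccontr)
    assume "\<not> ?thesis"
    then have "(\<Sum>a\<in>P. \<Sum>b\<in>nbs P a. x a + x b - 1) \<le> 0"
      by (intro sum_nonpos) (auto simp: not_less)
    then show False using two_\<sigma> t_less_\<sigma> by simp
  qed
  then show ?thesis using that by (auto simp: nbs_def)
qed

lemma d_le_D: "a \<in> P \<Longrightarrow> d a \<le> D"
  by (simp add: D_def fin)

lemma D_pos: "0 < D"
proof -
  obtain a b where "a \<in> P" "b \<in> P" "{a, b} \<in> E" by (rule heavy_edge)
  then have "nbs P a \<noteq> {}" by (auto simp: nbs_def)
  then have "0 < d a" by (simp add: d_def card_gt_0_iff fin)
  then show ?thesis using d_le_D[OF \<open>a \<in> P\<close>] by simp
qed

text \<open>If \<open>w\<close> is not bad, its non-neighbours in \<open>P\<close> form a vertex cover of the edges inside \<open>P\<close>. Since no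
weight exceeds \<open>1\<close>, an edge contributes at most the weight of either of its ends to \<open>\<sigma>\<close>; charging it to an
end in the cover charges no vertex more than \<open>D\<close> times.\<close>
lemma cover:
  assumes w: "w \<in> U - bad"
  shows "\<sigma> \<le> D * (\<Sum>a\<in>P - nbs P w. x a)"
proof -
  define y where "y = (\<lambda>a. if a \<in> nbs P w then 0 else x a)"
  have y0: "0 \<le> y a" if "a \<in> P" for a using x_nonneg that sub by (auto simp: y_def)
  have "2 * \<sigma> \<le> (\<Sum>a\<in>P. \<Sum>b\<in>nbs P a. y a + y b)"
    unfolding two_\<sigma>
  proof (intro sum_mono)
    fix a b assume a: "a \<in> P" and b: "b \<in> nbs P a"
    have "a \<notin> nbs P w \<or> b \<notin> nbs P w" using w a b by (auto simp: bad_def nbs_def)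
    moreover have "b \<in> P" using b by (simp add: nbs_def)
    ultimately show "x a + x b - 1 \<le> y a + y b"
      using x_le_1[of a] x_le_1[of b] x_nonneg[of a] x_nonneg[of b] a sub by (auto simp: y_def)
  qed
  also have "(\<Sum>a\<in>P. \<Sum>b\<in>nbs P a. y a + y b) = 2 * (\<Sum>a\<in>P. d a * y a)"
  proof -
    have "(\<Sum>a\<in>P. \<Sum>b\<in>nbs P a. y b) = (\<Sum>a\<in>P. d a * y a)"
      by (subst sum_nbs_swap) (auto simp: fin d_def)
    then show ?thesis by (simp add: sum.distrib d_def)
  qed
  also have "(\<Sum>a\<in>P. d a * y a) \<le> (\<Sum>a\<in>P. D * y a)"
    using d_le_D y0 by (intro sum_mono mult_right_mono) auto
  also have "\<dots> = D * (\<Sum>a\<in>P - nbs P w. x a)"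
    unfolding sum_distrib_left[symmetric] y_def
    by (simp add: sum.If_cases fin Diff_eq)
  finally show ?thesis by simp
qed

lemma n_nonneg: "w \<in> U \<Longrightarrow> 0 \<le> n w"
  using x_nonneg sub by (auto simp: n_def nbs_def intro!: sum_nonneg)

text \<open>The difference of the eigenvalue equations at \<open>u\<close> and at \<open>w\<close>. Being non-adjacent to much of \<open>P\<close> makes
\<open>w\<close> light, up to the weight \<open>n w\<close> that \<open>w\<close> recovers from neighbours in \<open>U\<close>.\<close>
lemma mu_deficit:
  assumes "w \<in> U"
  shows "\<mu> * (1 - x w) = (\<Sum>a\<in>P - nbs P w. x a) - n w"
proof -
  have "(\<Sum>a\<in>P - nbs P w. x a) = \<mu> - (\<Sum>a\<in>nbs P w. x a)"
    using sum_diff[of P "nbs P w" x] fin sum_P by (auto simp: nbs_def)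
  moreover have "\<mu> * x w = (\<Sum>a\<in>nbs P w. x a) + n w"
    using eigen[of w] assms sub by (auto simp: sum_nbs_split n_def)
  ultimately show ?thesis by (simp add: algebra_simps)
qed

lemma d_lower:
  assumes "w \<in> U"
  shows "\<mu> * x w - n w \<le> d w"
proof -
  have "(\<Sum>a\<in>nbs P w. x a) \<le> (\<Sum>a\<in>nbs P w. 1)" using x_le_1 sub by (intro sum_mono) (auto simp: nbs_def)
  moreover have "\<mu> * x w = (\<Sum>a\<in>nbs P w. x a) + n w"
    using eigen[of w] assms sub by (auto simp: sum_nbs_split n_def)
  ultimately show ?thesis by (simp add: d_def)
qed

text \<open>Without edges inside \<open>U\<close> the two factors on the right would be at least \<open>\<mu> * x w\<close> and \<open>\<beta> / \<mu>\<close>; the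
subtracted terms are the price of the weight \<open>n w\<close>, by which either estimate may fail.\<close>
lemma good_deficit:
  assumes w: "w \<in> U - bad"
  shows "\<beta> * x w - n w * x w - \<beta> * n w / \<mu> \<le> d w * (1 - x w)"
proof -
  have wU: "w \<in> U" "w \<in> V" using w sub by auto
  have \<beta>0: "0 \<le> \<beta>" using t_less_\<sigma> by (simp add: \<beta>_def)
  have "\<beta> \<le> (\<Sum>a\<in>P - nbs P w. x a)" using cover[OF w] D_pos by (simp add: \<beta>_def divide_le_eq mult.commute)
  then have "\<beta> - n w \<le> \<mu> * (1 - x w)" using mu_deficit[OF wU(1)] by simp
  then have "(\<mu> * x w) * \<beta> - n w * \<beta> - (\<mu> * x w) * n w \<le> d w * (\<mu> * (1 - x w))"
    using \<beta>0 n_nonneg[OF wU(1)] x_nonneg[OF wU(2)] x_le_1[OF wU(2)] mu_pos d_lower[OF wU(1)]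
    by (intro mult_minus_minus_lower) auto
  then have "\<mu> * (\<beta> * x w - n w * x w - \<beta> * n w / \<mu>) \<le> \<mu> * (d w * (1 - x w))"
    using mu_pos by (simp add: algebra_simps)
  then show ?thesis using mu_pos by simp
qed

lemma sum_n_le: "(\<Sum>w\<in>U. n w) \<le> 2 * t"
proof -
  have "n w \<le> card (nbs U w)" if "w \<in> U" for w
    using sum_bounded_above[of "nbs U w" x 1] x_le_1 sub by (auto simp: n_def nbs_def)
  then have "(\<Sum>w\<in>U. n w) \<le> (\<Sum>w\<in>U. real (card (nbs U w)))" by (intro sum_mono)
  also have "\<dots> = 2 * t" using handshake[OF fin(2)] by (simp add: t_def flip: of_nat_sum)
  finally show ?thesis .
qed

text \<open>Summing the deficits of the good vertices and comparing with the total allowed by \<open>deficit\<close>: up to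
correction terms for the edges inside \<open>U\<close>, the good vertices together weigh less than \<open>D\<close>.\<close>
lemma good_weight: "\<beta> * (X - D) < t + 2 * \<beta> * t / \<mu>"
proof -
  have \<beta>0: "0 \<le> \<beta>" and \<beta>D: "\<sigma> = \<beta> * D" using t_less_\<sigma> D_pos by (auto simp: \<beta>_def)
  have "\<beta> * X - (\<Sum>w\<in>U - bad. n w * x w) - \<beta> * (\<Sum>w\<in>U - bad. n w) / \<mu>
      = (\<Sum>w\<in>U - bad. \<beta> * x w - n w * x w - \<beta> * n w / \<mu>)"
    by (simp add: sum_subtractf X_def sum_distrib_left sum_divide_distrib)
  also have "\<dots> \<le> (\<Sum>w\<in>U - bad. d w * (1 - x w))"
    by (intro sum_mono good_deficit)
  also have "\<dots> \<le> (\<Sum>w\<in>U. d w * (1 - x w))"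
    using fin x_le_1 sub by (intro sum_mono2 mult_nonneg_nonneg) auto
  also have "\<dots> < \<beta> * D - t" using deficit \<beta>D by simp
  finally have main: "\<beta> * X - (\<Sum>w\<in>U - bad. n w * x w) - \<beta> * (\<Sum>w\<in>U - bad. n w) / \<mu> < \<beta> * D - t" .
  have "(\<Sum>w\<in>U - bad. n w) \<le> (\<Sum>w\<in>U. n w)"
    using fin n_nonneg by (intro sum_mono2) auto
  then have n2: "(\<Sum>w\<in>U - bad. n w) \<le> 2 * t" using sum_n_le by simp
  have "(\<Sum>w\<in>U - bad. n w * x w) \<le> (\<Sum>w\<in>U - bad. n w)"
    using n_nonneg x_le_1 sub by (intro sum_mono mult_left_le) auto
  then have "(\<Sum>w\<in>U - bad. n w * x w) \<le> 2 * t" using n2 by simp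
  moreover have "\<beta> * (\<Sum>w\<in>U - bad. n w) / \<mu> \<le> \<beta> * (2 * t) / \<mu>"
    using n2 \<beta>0 mu_pos by (intro divide_right_mono mult_left_mono) auto
  ultimately show ?thesis using main by (simp add: algebra_simps)
qed

text \<open>The neighbourhoods of \<open>a\<close> and \<open>b\<close> carry weight \<open>\<mu> * (x a + x b)\<close>. Inside \<open>U\<close> they overlap in bad
vertices only, so a shortage of bad vertices forces much weight on the good ones.\<close>
lemma heavy_edge_bound:
  assumes "a \<in> P" "b \<in> P" "{a, b} \<in> E" "1 < x a + x b"
  shows "\<mu> < d a + d b + X + 2 * card bad"
proof -
  have xV: "0 \<le> x v" "x v \<le> 1" if "v \<in> U \<or> v \<in> P" for v using that x_nonneg x_le_1 sub by auto
  have abV: "a \<in> V" "b \<in> V" using assms sub by auto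
  have d: "(\<Sum>w\<in>nbs P v. x w) \<le> d v" for v
    using sum_bounded_above[of "nbs P v" x 1] xV by (auto simp: d_def nbs_def)
  have "(\<Sum>w\<in>nbs U a. x w) + (\<Sum>w\<in>nbs U b. x w) = (\<Sum>w\<in>nbs U a \<union> nbs U b. x w) + (\<Sum>w\<in>nbs U a \<inter> nbs U b. x w)"
    by (rule sum.union_inter[symmetric]) (auto simp: fin)
  also have "(\<Sum>w\<in>nbs U a \<union> nbs U b. x w) \<le> (\<Sum>w\<in>U. x w)"
    using fin xV by (intro sum_mono2) (auto simp: nbs_def)
  also have "(\<Sum>w\<in>nbs U a \<inter> nbs U b. x w) \<le> (\<Sum>w\<in>bad. x w)"
    using fin xV sub assms by (intro sum_mono2) (auto simp: nbs_def bad_def insert_commute)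
  also have "(\<Sum>w\<in>U. x w) = X + (\<Sum>w\<in>bad. x w)"
    unfolding X_def using sub fin by (intro sum.subset_diff) auto
  finally have "(\<Sum>w\<in>nbs U a. x w) + (\<Sum>w\<in>nbs U b. x w) \<le> X + 2 * (\<Sum>w\<in>bad. x w)" by simp
  moreover have "(\<Sum>w\<in>bad. x w) \<le> (\<Sum>w\<in>bad. 1)"
    using xV(2) sub(3) by (intro sum_mono) auto
  moreover have "\<mu> * x a + \<mu> * x b = (\<Sum>w\<in>nbs P a. x w) + (\<Sum>w\<in>nbs U a. x w) + (\<Sum>w\<in>nbs P b. x w) + (\<Sum>w\<in>nbs U b. x w)"
    using eigen[OF abV(1)] eigen[OF abV(2)] by (simp add: sum_nbs_split)
  moreover have "\<mu> * 1 < \<mu> * (x a + x b)" using assms mu_pos by (intro mult_strict_left_mono) auto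
  ultimately show ?thesis using d[of a] d[of b] by (simp add: algebra_simps)
qed

lemma d_edge_bound:
  assumes "a \<in> P" "b \<in> P" "{a, b} \<in> E"
  shows "d a + d b \<le> s + 1"
proof -
  define F where "F = (\<lambda>v. (\<lambda>z. {v, z}) ` nbs P v)"
  have card_F: "card (F v) = d v" for v
    unfolding F_def d_def by (intro card_image inj_onI) (auto simp: doubleton_eq_iff)
  have "F a \<inter> F b \<subseteq> {{a, b}}" using assms not_adjacent_self by (auto simp: F_def doubleton_eq_iff nbs_def)
  then have "card (F a \<inter> F b) \<le> 1" using card_mono[of "{{a, b}}"] by simp
  moreover have "card (F a \<union> F b) \<le> s"
    unfolding s_def using assms finite_E by (intro card_mono) (auto simp: F_def nbs_def)
  moreover have "card (F a) + card (F b) = card (F a \<union> F b) + card (F a \<inter> F b)"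
    by (rule card_Un_Int) (auto simp: F_def fin)
  ultimately show ?thesis by (simp add: card_F)
qed

lemma u_bad: "u \<in> bad"
proof -
  obtain a b where "a \<in> P" "b \<in> P" "{a, b} \<in> E" by (rule heavy_edge)
  then show ?thesis using u_in_U by (auto simp: bad_def P_def nbs_def)
qed

text \<open>Three kinds of triangular edges are counted: those inside \<open>P\<close>, which form triangles with \<open>u\<close>; those from
\<open>u\<close> to a vertex of maximal degree inside \<open>P\<close> and to its neighbours there, which are \<open>D + 1\<close> edges;
and two edges into \<open>P\<close> from each bad vertex other than \<open>u\<close>. In the proof \<open>C w\<close> collects the neighbours
\<open>a \<in> P\<close> of \<open>w\<close> for which \<open>{w, a}\<close> lies in a triangle whose third vertex is in \<open>P\<close>.\<close>
lemma triangular_lower: "s + D + 2 * card bad \<le> card (triangular_edges E) + 1"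
proof -
  define C where "C = (\<lambda>w. {a \<in> nbs P w. \<exists>b\<in>nbs P w. {a, b} \<in> E})"
  define F where "F = (\<lambda>(w, a). {w, a}) ` Sigma U C"
  have finC: "finite (C w)" for w by (simp add: C_def fin)
  have "card F = card (Sigma U C)"
    unfolding F_def using sub by (intro card_image inj_onI) (auto simp: doubleton_eq_iff C_def nbs_def)
  also have "\<dots> = (\<Sum>w\<in>U. card (C w))" using fin finC by simp
  also have "\<dots> \<ge> (\<Sum>w\<in>bad. card (C w))" using fin sub by (intro sum_mono2) auto
  also have "(\<Sum>w\<in>bad. card (C w)) = card (C u) + (\<Sum>w\<in>bad - {u}. card (C w))"
    using fin u_bad by (intro sum.remove) auto
  finally have F: "card (C u) + (\<Sum>w\<in>bad - {u}. card (C w)) \<le> card F" .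
  have "2 \<le> card (C w)" if w: "w \<in> bad" for w
  proof -
    obtain a b where "a \<in> P" "b \<in> P" "{a, b} \<in> E" "{w, a} \<in> E" "{w, b} \<in> E"
      using w by (auto simp: bad_def)
    then have "{a, b} \<subseteq> C w" by (auto simp: C_def nbs_def insert_commute)
    then have "card {a, b} \<le> card (C w)" using finC by (intro card_mono)
    then show ?thesis using \<open>{a, b} \<in> E\<close> edge_card by simp
  qed
  then have "(\<Sum>w\<in>bad - {u}. 2) \<le> (\<Sum>w\<in>bad - {u}. card (C w))" by (intro sum_mono) auto
  then have F': "2 * (card bad - 1) \<le> (\<Sum>w\<in>bad - {u}. card (C w))" using fin u_bad by simp
  have "P \<noteq> {}" using heavy_edge by blast
  then have "D \<in> d ` P" unfolding D_def using fin by (intro Max_in) auto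
  then obtain c where c: "c \<in> P" "d c = D" by auto
  have "nbs P c \<noteq> {}" using D_pos c(2) by (auto simp: d_def)
  then have "insert c (nbs P c) \<subseteq> C u"
    using c(1) by (auto simp: C_def P_def nbs_def insert_commute)
  then have "card (insert c (nbs P c)) \<le> card (C u)" using finC by (intro card_mono)
  moreover have "c \<notin> nbs P c" using not_adjacent_self by (simp add: nbs_def)
  ultimately have Cu: "D + 1 \<le> card (C u)" using fin c(2) by (simp add: d_def)
  have "card bad \<noteq> 0" using u_bad fin by auto
  have "{e \<in> E. e \<subseteq> P} \<inter> F = {}" using sub by (auto simp: F_def)
  moreover have "finite F" unfolding F_def using fin finC by (intro finite_imageI finite_SigmaI)
  ultimately have "s + card F = card ({e \<in> E. e \<subseteq> P} \<union> F)"
    using finite_E by (simp add: s_def card_Un_disjoint)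
  also have "\<dots> \<le> card (triangular_edges E)"
  proof (rule card_mono)
    show "finite (triangular_edges E)" using finite_E by (simp add: triangular_edges_def)
    have "e \<in> triangular_edges E" if e: "e \<in> E" "e \<subseteq> P" for e
    proof -
      obtain a b where "e = {a, b}" using edge_card[OF e(1)] by (auto simp: card_2_iff)
      then have "Defs.triangle E u a b" using e by (auto simp: Defs.triangle_def P_def nbs_def)
      then show ?thesis using e \<open>e = {a, b}\<close> unfolding triangular_edges_def by blast
    qed
    moreover have "e \<in> triangular_edges E" if eF: "e \<in> F" for e
    proof -
      obtain w a where wa: "e = {w, a}" "a \<in> C w" using eF by (auto simp: F_def)
      then obtain b where "b \<in> nbs P w" "{a, b} \<in> E" by (auto simp: C_def)
      with wa have "Defs.triangle E w a b" "e \<in> E" "e \<subseteq> {w, a, b}" by (auto simp: Defs.triangle_def C_def nbs_def)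
      then show ?thesis unfolding triangular_edges_def by blast
    qed
    ultimately show "{e \<in> E. e \<subseteq> P} \<union> F \<subseteq> triangular_edges E" by auto
  qed
  finally show ?thesis using F F' Cu \<open>card bad \<noteq> 0\<close> by linarith
qed

text \<open>If \<open>2 * T \<le> \<mu>\<close>, the heavy edge and the count of triangular edges give \<open>\<mu> < T + 2 - D + X\<close>, where \<open>X\<close> is
less than \<open>D\<close> if \<open>t = 0\<close> and less than \<open>2 * D + 1\<close> if \<open>t > 0\<close>. The first leads to \<open>T < 2\<close>, which is absurd
as there is a triangle. The second leads to \<open>T \<le> D + 2\<close> and hence \<open>s \<le> 1\<close>, whereas \<open>0 < t < s\<close>.\<close>
theorem eigenvalue_less_twice_triangular: "\<mu> < 2 * card (triangular_edges E)"
proof (rule ccontr)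
  define T where "T = card (triangular_edges E)"
  assume "\<not> ?thesis"
  then have T2: "2 * T \<le> \<mu>" by (simp add: T_def)
  obtain a b where ab: "a \<in> P" "b \<in> P" "{a, b} \<in> E" "1 < x a + x b" by (rule heavy_edge)
  have l1: "\<mu> < s + 1 + X + 2 * card bad"
    using heavy_edge_bound[OF ab] d_edge_bound[OF ab(1-3)] by linarith
  have TT: "s + D + 2 * card bad \<le> T + 1" using triangular_lower by (simp add: T_def)
  have "card bad \<noteq> 0" using u_bad fin by auto
  then have k: "1 \<le> card bad" by simp
  have \<beta>0: "0 < \<beta>" and \<beta>D: "\<sigma> = \<beta> * D" using t_less_\<sigma> D_pos by (auto simp: \<beta>_def)
  have gw: "\<beta> * (X - D) < t + 2 * \<beta> * t / \<mu>" by (rule good_weight)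
  have l2: "\<mu> < T + 2 - D + X" using l1 TT by linarith
  show False
  proof (cases "t = 0")
    case True
    then have "X < D" using gw \<beta>0 by (simp add: mult_less_0_iff)
    then show False using l2 T2 TT k D_pos t_less_s by linarith
  next
    case False
    have "s \<le> T" using TT k D_pos by linarith
    then have "2 * real t \<le> \<mu>" using t_less_s T2 by linarith
    then have "\<beta> * (2 * real t / \<mu>) \<le> \<beta> * 1" using \<beta>0 mu_pos by (intro mult_left_mono) auto
    then have "\<beta> * (X - D) < \<beta> * (D + 1)" using gw t_less_\<sigma> \<beta>D by (simp add: algebra_simps)
    then have "X < 2 * D + 1" using \<beta>0 by simp
    then have "2 * T < T + D + 3" using l2 T2 by linarith
    then show False using TT k False t_less_s by linarith
  qed
qed

end

section \<open>From the adjacency matrix to vertex weights\<close>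

theorem corollary1p7:
  fixes V :: "'a set" and E :: "'a set set" and vs :: "'a list" and m :: nat
  assumes "finite_simple_graph V E" and "V \<noteq> {}"
    and "distinct vs" and "set vs = V"
    and "m = card E"
    and "largest_eigenvalue (adjacency_matrix vs E) > sqrt (real m)"
  shows "real (card (triangular_edges E)) > 1 / 2 * sqrt (real m)"
proof -
  define A where "A = adjacency_matrix vs E"
  define \<mu> where "\<mu> = largest_eigenvalue A"
  interpret simple_graph V E using assms(1) by unfold_locales
  have "0 \<le> sqrt (real m)" by simp
  then have pos: "0 < \<mu>" using assms(6) unfolding \<mu>_def A_def by linarith
  have A: "A \<in> carrier_mat (length vs) (length vs)"
    by (simp add: A_def adjacency_matrix_def)
  have entry: "A $$ (i, j) = (if {vs ! i, vs ! j} \<in> E then 1 else 0)"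
    if "i < length vs" "j < length vs" for i j
    using that by (simp add: A_def adjacency_matrix_def)
  have len: "0 < length vs" using assms(2,4) by auto
  show ?thesis
  proof (rule largest_eigenvalue_nonneg_eigenvector[OF A len])
    fix y
    assume y0: "\<And>i. i < length vs \<Longrightarrow> 0 \<le> y i" and y1: "\<exists>i<length vs. 0 < y i"
      and yA: "\<And>i. i < length vs \<Longrightarrow> (\<Sum>j<length vs. A $$ (i, j) * y j) = largest_eigenvalue A * y i"
    have bij: "bij_betw ((!) vs) {..<length vs} V" using assms(3,4) by (intro bij_betw_nth) auto
    define x where "x = (\<lambda>v. y (the_inv_into {..<length vs} ((!) vs) v))"
    have x_nth: "x (vs ! i) = y i" if "i < length vs" for i
      unfolding x_def using the_inv_into_f_f[OF bij_betw_imp_inj_on[OF bij]] that by simp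
    have V_nth: "\<exists>i<length vs. v = vs ! i" if "v \<in> V" for v
      using that assms(4) by (metis in_set_conv_nth)
    have x0: "0 \<le> x v" if "v \<in> V" for v using V_nth[OF that] y0 x_nth by auto
    have eig: "(\<Sum>w\<in>nbs V v. x w) = \<mu> * x v" if "v \<in> V" for v
    proof -
      obtain i where i: "i < length vs" "v = vs ! i" using V_nth[OF \<open>v \<in> V\<close>] by blast
      have "(\<Sum>w\<in>nbs V v. x w) = (\<Sum>w\<in>V. if {v, w} \<in> E then x w else 0)"
        unfolding nbs_def by (rule sum.inter_filter) (rule finite_V)
      also have "\<dots> = (\<Sum>j<length vs. if {v, vs ! j} \<in> E then x (vs ! j) else 0)"
        by (rule sum.reindex_bij_betw[OF bij, symmetric])
      also have "\<dots> = (\<Sum>j<length vs. A $$ (i, j) * y j)"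
        by (rule sum.cong) (auto simp: entry i x_nth)
      also have "\<dots> = \<mu> * x v" using yA[of i] i x_nth by (simp add: \<mu>_def)
      finally show ?thesis .
    qed
    obtain u where u: "u \<in> V" "\<And>v. v \<in> V \<Longrightarrow> x v \<le> x u"
      using Max_in[of "x ` V"] Max_ge[of "x ` V"] finite_V assms(2) by fastforce
    have xu: "0 < x u"
    proof -
      obtain i where i: "i < length vs" "0 < y i" using y1 by blast
      then have "vs ! i \<in> V" using assms(4) by auto
      then show ?thesis using u(2) x_nth i by fastforce
    qed
    have "sqrt (real (card E)) < \<mu>" using assms(5,6) by (simp add: \<mu>_def A_def)
    then have "real (card E) < \<mu>\<^sup>2"
      using power_strict_mono[of "sqrt (real (card E))" \<mu> 2] by simp
    then interpret perron_graph V E "\<lambda>v. x v / x u" \<mu> u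
      using x0 u xu eig pos by unfold_locales (auto simp: sum_divide_distrib[symmetric] divide_le_eq)
    show ?thesis using eigenvalue_less_twice_triangular assms(6) by (simp add: \<mu>_def A_def)
  qed (auto simp: entry insert_commute)
qed

end
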